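(* For $w\in\mathbb N$, $\textsc{ReLU}$ networks $f:\mathbb R\to\mathbb R^2$ of width $w$ are dense in $C([0,1],\mathbb{R}^2)$ if and only if $w \ge 3$.
   Context: A neural network $f:\mathbb R^{d_x}\to\mathbb R^{d_y}$ with $L$ layers and hidden dimensions $d_1,\dots,d_{L-1}$ (set $d_0=d_x$, $d_L=d_y$) is a map $f=t_L\circ\sigma_{L-1}\circ\cdots\circ t_2\circ\sigma_1\circ t_1$, where each $t_\ell:\mathbb R^{d_{\ell-1}}\to\mathbb R^{d_\ell}$ is affine and $\sigma_\ell$ applies $\textsc{ReLU}(x)=\max\{x,0\}$ coordinatewise. The width of $f$ is $\max\{d_1,\dots,d_{L-1}\}$; the depth is arbitrary. $C([0,1],\mathbb R^2)$ is endowed with the uniform norm $\|g\|_\infty=\sup_{x\in[0,1]}\|g(x)\|_\infty$, and "dense" means: for every $f^*\in C([0,1],\mathbb R^2)$ and every $\varepsilon>0$ there is such a network $f$ with $\sup_{x\in[0,1]}\|f^*(x)-f(x)\|_\infty\le\varepsilon$. *)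

theory Defs
  imports "HOL-Analysis.Analysis"
begin

text \<open>Vectors in R^d are represented as real lists of length d.
  An affine map t : R^m -> R^n is a pair (W, b) of an n-row weight matrix
  (list of rows, each of length m) and a bias vector of length n.\<close>

type_synonym affine = "real list list \<times> real list"

definition affine_ok :: "nat \<Rightarrow> nat \<Rightarrow> affine \<Rightarrow> bool" where
  "affine_ok m n t \<longleftrightarrow> length (fst t) = n \<and> length (snd t) = n \<and>
     (\<forall>r\<in>set (fst t). length r = m)"

definition apply_affine :: "affine \<Rightarrow> real list \<Rightarrow> real list" where
  "apply_affine t x = map2 (\<lambda>r c. sum_list (map2 (*) r x) + c) (fst t) (snd t)"

definition relu :: "real \<Rightarrow> real" where
  "relu x = max x 0"

definition relu_vec :: "real list \<Rightarrow> real list" where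
  "relu_vec v = map relu v"

fun eval_net :: "affine list \<Rightarrow> real list \<Rightarrow> real list" where
  "eval_net [] x = x"
| "eval_net [t] x = apply_affine t x"
| "eval_net (t # ts) x = eval_net ts (relu_vec (apply_affine t x))"

definition is_net :: "nat \<Rightarrow> nat \<Rightarrow> nat list \<Rightarrow> affine list \<Rightarrow> bool" where
  "is_net dx dy ds ts \<longleftrightarrow> length ts \<ge> 1 \<and> length ds = length ts + 1 \<and>
     ds ! 0 = dx \<and> ds ! length ts = dy \<and>
     (\<forall>i. 0 < i \<and> i < length ts \<longrightarrow> ds ! i \<ge> 1) \<and>
     (\<forall>i < length ts. affine_ok (ds ! i) (ds ! Suc i) (ts ! i))"

text \<open>Width = max of hidden dimensions d_1..d_{L-1} (0 if there is no hidden layer).\<close>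
definition net_width :: "nat list \<Rightarrow> nat" where
  "net_width ds = Max (insert 0 {ds ! i | i. 0 < i \<and> i < length ds - 1})"

definition relu_dense_width_1_2 :: "nat \<Rightarrow> bool" where
  "relu_dense_width_1_2 w \<longleftrightarrow>
     (\<forall>(fs :: real \<Rightarrow> real \<times> real) (\<epsilon>::real). continuous_on {0..1} fs \<and> \<epsilon> > 0 \<longrightarrow>
        (\<exists>ds ts. is_net 1 2 ds ts \<and> net_width ds = w \<and>
           (\<forall>x\<in>{0..1}. \<bar>fst (fs x) - eval_net ts [x] ! 0\<bar> \<le> \<epsilon> \<and>
                        \<bar>snd (fs x) - eval_net ts [x] ! 1\<bar> \<le> \<epsilon>)))"

end

theory Submission
  imports Defs
begin

text \<open>Width two is too small because every network of width at most two is a uniform limit of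
  injective curves: perturb each affine map to an invertible one and replace ReLU by the strictly
  increasing function \<open>relu u + \<delta> * u\<close>. A curve that crosses a square first horizontally and later
  vertically is not such a limit, since by the Fashoda theorem the two crossings of any nearby curve
  still meet.

  Width three suffices because one neuron can carry the input \<open>x\<close> while the other two carry two values,
  and one layer can replace each value \<open>y\<close> by its maximum or minimum with an affine function
  of \<open>x\<close>. Clamping successively at grid points from left to right between pairs of steep lines
  produces uniform approximations of any continuous function.\<close>

section \<open>Uniform limits of injective curves\<close>

text \<open>The approximating curves \<open>g\<close> are arbitrary and need not be networks, so the
  property can be pushed through one layer at a time.\<close>

definition injective_limit :: "(real \<Rightarrow> real \<times> real) \<Rightarrow> bool" where
  "injective_limit h \<longleftrightarrow> (\<forall>\<eta>>0. \<exists>g. continuous_on {0..1} g \<and> inj_on g {0..1} \<and>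
     (\<forall>x\<in>{0..1}. dist (g x) (h x) \<le> \<eta>))"

text \<open>Apply \<open>F\<close> to an injective approximant \<open>g\<close> of \<open>h\<close>
  and add a small multiple of \<open>g\<close> to restore injectivity. Uniform continuity of
  \<open>F\<close> and boundedness of \<open>g\<close> keep the error small. The assumption asks for
  arbitrarily small good \<open>\<delta>\<close> rather than all small ones, because single values
  can fail.\<close>

lemma injective_limit_comp:
  fixes F :: "real \<times> real \<Rightarrow> real \<times> real"
  assumes h: "injective_limit h" and uc: "uniformly_continuous_on UNIV F"
    and pert: "\<And>\<delta>\<^sub>0. \<delta>\<^sub>0 > 0 \<Longrightarrow> \<exists>\<delta>>0. \<delta> < \<delta>\<^sub>0 \<and> inj (\<lambda>z. F z + \<delta> *\<^sub>R z)"
  shows "injective_limit (\<lambda>x. F (h x))"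
  unfolding injective_limit_def
proof (intro allI impI)
  fix \<eta> :: real assume \<eta>: "\<eta> > 0"
  obtain d where d: "d > 0" "\<And>z z'. dist z z' < d \<Longrightarrow> dist (F z) (F z') < \<eta>/2"
    using uc \<eta> unfolding uniformly_continuous_on_def by (metis UNIV_I half_gt_zero)
  obtain g where g: "continuous_on {0..1} g" "inj_on g {0..1}"
      "\<And>x. x \<in> {0..1} \<Longrightarrow> dist (g x) (h x) \<le> d/2"
    using h d(1) unfolding injective_limit_def by (meson half_gt_zero)
  have "bounded (g ` {0..1})"
    using g(1) by (simp add: compact_continuous_image compact_imp_bounded)
  then obtain M where M: "M > 0" "\<And>x. x \<in> {0..1} \<Longrightarrow> norm (g x) \<le> M"
    unfolding bounded_pos by blast
  obtain \<delta> where \<delta>: "\<delta> > 0" "\<delta> < \<eta>/(2*M)" "inj (\<lambda>z. F z + \<delta> *\<^sub>R z)"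
    using pert[of "\<eta>/(2*M)"] \<eta> M(1) by auto
  let ?g = "\<lambda>x. F (g x) + \<delta> *\<^sub>R g x"
  have cF: "continuous_on UNIV F"
    using uc by (rule uniformly_continuous_imp_continuous)
  have "continuous_on {0..1} ?g"
    by (intro continuous_intros continuous_on_compose2[OF cF g(1)] g(1)) auto
  moreover have "inj_on ?g {0..1}"
    using comp_inj_on[OF g(2) inj_on_subset[OF \<delta>(3) subset_UNIV]] by (simp add: comp_def)
  moreover have "dist (?g x) (F (h x)) \<le> \<eta>" if x: "x \<in> {0..1}" for x
  proof -
    have "dist (?g x) (F (g x)) = \<delta> * norm (g x)"
      using \<delta>(1) by (simp add: dist_norm)
    also have "\<dots> \<le> \<eta>/(2*M) * M"
      using \<delta> M(2)[OF x] by (intro mult_mono) auto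
    also have "\<dots> = \<eta>/2" using M(1) by simp
    finally have "dist (?g x) (F (g x)) \<le> \<eta>/2" .
    moreover have "dist (F (g x)) (F (h x)) < \<eta>/2"
      using g(3)[OF x] d by (intro d(2)) linarith
    ultimately show ?thesis
      using dist_triangle[of "?g x" "F (h x)" "F (g x)"] by linarith
  qed
  ultimately show "\<exists>g. continuous_on {0..1} g \<and> inj_on g {0..1} \<and>
     (\<forall>x\<in>{0..1}. dist (g x) (F (h x)) \<le> \<eta>)" by blast
qed

text \<open>ReLU is 1-Lipschitz, and adding a positive multiple of the identity makes it strictly
  increasing in each coordinate.\<close>

lemma injective_limit_relu:
  assumes "injective_limit h"
  shows "injective_limit (\<lambda>x. (relu (fst (h x)), relu (snd (h x))))"
proof -
  let ?F = "\<lambda>z::real \<times> real. (relu (fst z), relu (snd z))"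
  have relu_dist: "dist (relu a) (relu b) \<le> dist a b" for a b
    by (auto simp: relu_def dist_real_def)
  have "dist (?F z) (?F z') \<le> dist z z'" for z z'
    unfolding dist_prod_def
    by (intro real_sqrt_le_mono add_mono power_mono) (auto simp: relu_dist)
  then have uc: "uniformly_continuous_on UNIV ?F"
    unfolding uniformly_continuous_on_def by (meson le_less_trans)
  have relu_inj: "a = b" if "\<delta> > 0" "relu a + \<delta> * a = relu b + \<delta> * b" for a b \<delta> :: real
  proof (rule ccontr)
    assume "a \<noteq> b"
    then consider "a < b" | "b < a" by linarith
    then show False
    proof cases
      case 1
      then have "\<delta> * a < \<delta> * b" "relu a \<le> relu b" using that by (auto simp: relu_def)
      then show False using that by linarith
    next
      case 2
      then have "\<delta> * b < \<delta> * a" "relu b \<le> relu a" using that by (auto simp: relu_def)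
      then show False using that by linarith
    qed
  qed
  show ?thesis
  proof (rule injective_limit_comp[OF assms uc])
    fix \<delta>\<^sub>0 :: real assume "\<delta>\<^sub>0 > 0"
    moreover have "inj (\<lambda>z. ?F z + (\<delta>\<^sub>0/2) *\<^sub>R z)"
    proof (rule injI)
      fix z z' assume "?F z + (\<delta>\<^sub>0/2) *\<^sub>R z = ?F z' + (\<delta>\<^sub>0/2) *\<^sub>R z'"
      then have "relu (fst z) + \<delta>\<^sub>0/2 * fst z = relu (fst z') + \<delta>\<^sub>0/2 * fst z'"
        "relu (snd z) + \<delta>\<^sub>0/2 * snd z = relu (snd z') + \<delta>\<^sub>0/2 * snd z'"
        by (simp_all add: prod_eq_iff)
      then show "z = z'"
        using relu_inj[OF half_gt_zero[OF \<open>\<delta>\<^sub>0 > 0\<close>]] prod_eqI by blast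
    qed
    ultimately show "\<exists>\<delta>>0. \<delta> < \<delta>\<^sub>0 \<and> inj (\<lambda>z. ?F z + \<delta> *\<^sub>R z)"
      by (intro exI[of _ "\<delta>\<^sub>0/2"]) auto
  qed
qed

lemma inj_affine_plane:
  fixes a b c d e f :: real
  assumes "a * d - b * c \<noteq> 0"
  shows "inj (\<lambda>z. (a * fst z + b * snd z + e, c * fst z + d * snd z + f))"
proof (rule injI)
  fix z z' :: "real \<times> real"
  assume "(a * fst z + b * snd z + e, c * fst z + d * snd z + f) =
          (a * fst z' + b * snd z' + e, c * fst z' + d * snd z' + f)"
  then have 1: "a * (fst z - fst z') + b * (snd z - snd z') = 0"
    and 2: "c * (fst z - fst z') + d * (snd z - snd z') = 0"
    by (auto simp: algebra_simps)
  \<comment> \<open>Cramer's rule: each coordinate is isolated by eliminating the other.\<close>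
  have "(a*d - b*c) * (fst z - fst z') = 0" "(a*d - b*c) * (snd z - snd z') = 0"
    using 1 2 by algebra+
  then show "z = z'" using assms by (simp add: prod_eq_iff)
qed

lemma injective_limit_affine:
  fixes a b c d e f :: real
  assumes "injective_limit h"
  shows "injective_limit (\<lambda>x. (a * fst (h x) + b * snd (h x) + e, c * fst (h x) + d * snd (h x) + f))"
proof -
  let ?F = "\<lambda>z::real \<times> real. (a * fst z + b * snd z + e, c * fst z + d * snd z + f)"
  have "bounded_linear (\<lambda>z::real \<times> real. (a * fst z + b * snd z, c * fst z + d * snd z))"
    by (intro bounded_linear_Pair bounded_linear_add bounded_linear_const_mult
        bounded_linear_fst bounded_linear_snd)
  from bounded_linear.uniformly_continuous_on[OF this uniformly_continuous_on_id]
  have "uniformly_continuous_on UNIV (\<lambda>z::real \<times> real. (a * fst z + b * snd z, c * fst z + d * snd z) + (e, f))"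
    by (intro uniformly_continuous_on_add uniformly_continuous_on_const)
  then have uc: "uniformly_continuous_on UNIV ?F" by simp
  show ?thesis
  proof (rule injective_limit_comp[OF assms uc])
    fix \<delta>\<^sub>0 :: real assume "\<delta>\<^sub>0 > 0"
    \<comment> \<open>The polynomial is the determinant of the linear part plus
      \<open>\<delta>\<close> times the identity. It is monic, hence has finitely many roots, so
      arbitrarily small good \<open>\<delta>\<close> exist even for a singular matrix.\<close>
    have "finite {\<delta>. poly [:a*d - b*c, a + d, 1:] \<delta> = 0}"
      by (rule poly_roots_finite) simp
    moreover have "infinite {0<..<\<delta>\<^sub>0}" using \<open>\<delta>\<^sub>0 > 0\<close> by simp
    ultimately have "\<not> {0<..<\<delta>\<^sub>0} \<subseteq> {\<delta>. poly [:a*d - b*c, a + d, 1:] \<delta> = 0}"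
      using finite_subset by blast
    then obtain \<delta> where \<delta>: "0 < \<delta>" "\<delta> < \<delta>\<^sub>0" "poly [:a*d - b*c, a + d, 1:] \<delta> \<noteq> 0"
      unfolding subset_iff greaterThanLessThan_iff mem_Collect_eq by blast
    have "(a + \<delta>) * (d + \<delta>) - b * c \<noteq> 0" using \<delta>(3) by (simp add: algebra_simps)
    from inj_affine_plane[OF this, of e f]
    have "inj (\<lambda>z. ?F z + \<delta> *\<^sub>R z)"
      by (rule back_subst[of inj]) (auto simp: fun_eq_iff algebra_simps prod_eq_iff)
    with \<delta> show "\<exists>\<delta>>0. \<delta> < \<delta>\<^sub>0 \<and> inj (\<lambda>z. ?F z + \<delta> *\<^sub>R z)" by blast
  qed
qed

section \<open>Networks of width at most two\<close>

lemma length_apply_affine: "affine_ok m n t \<Longrightarrow> length (apply_affine t v) = n"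
  by (simp add: affine_ok_def apply_affine_def)

text \<open>Unlike in \<open>eval_net\<close>, ReLU also follows the last map, so the result is a
  hidden layer to which further layers can be appended.\<close>

definition hidden_state :: "affine list \<Rightarrow> real list \<Rightarrow> real list" where
  "hidden_state ts v = foldl (\<lambda>u t. relu_vec (apply_affine t u)) v ts"

lemma eval_net_snoc: "eval_net (ts @ [t]) v = apply_affine t (hidden_state ts v)"
proof (induction ts arbitrary: v)
  case (Cons s ts)
  then show ?case by (cases ts) (auto simp: hidden_state_def)
qed (simp add: hidden_state_def)

lemma length_eval_net:
  assumes "is_net dx dy ds ts"
  shows "length (eval_net ts v) = dy"
proof -
  have "ts \<noteq> []" using assms by (auto simp: is_net_def)
  then obtain us t where ts: "ts = us @ [t]" by (metis append_butlast_last_id)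
  have "affine_ok (ds ! length us) dy t"
    using assms unfolding is_net_def ts by (metis length_append_singleton lessI nth_append_length)
  then show ?thesis by (simp add: ts eval_net_snoc length_apply_affine)
qed

text \<open>Embeds the line as the first axis of the plane, so that layers of width one and two are
  handled alike. ReLU fixes the padding zero.\<close>

definition plane_point :: "real list \<Rightarrow> real \<times> real" where
  "plane_point v = (v ! 0, if length v = 1 then 0 else v ! 1)"

lemma length_1_or_2E:
  assumes "length v = m" "m \<in> {1, 2}"
  obtains a where "m = 1" "v = [a]" | a b where "m = 2" "v = [a, b]"
  using assms by (auto simp: length_Suc_conv numeral_2_eq_2)

lemma plane_point_affine:
  assumes ok: "affine_ok m n t" and m: "m \<in> {1, 2}" and n: "n \<in> {1, 2}"
  obtains a b e c d f where "\<And>v. length v = m \<Longrightarrow> plane_point (apply_affine t v) =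
     (a * fst (plane_point v) + b * snd (plane_point v) + e,
      c * fst (plane_point v) + d * snd (plane_point v) + f)"
proof -
  obtain W y where t: "t = (W, y)" by force
  have row: "\<exists>a b. \<forall>v. length v = m \<longrightarrow>
      sum_list (map2 (*) r v) = a * fst (plane_point v) + b * snd (plane_point v)"
    if "length r = m" for r :: "real list"
    using that m
  proof (cases rule: length_1_or_2E)
    case (1 a)
    then show ?thesis
      by (intro exI[of _ a] exI[of _ 0]) (auto simp: plane_point_def length_Suc_conv)
  next
    case (2 a b)
    then show ?thesis
      by (intro exI[of _ a] exI[of _ b]) (auto simp: plane_point_def length_Suc_conv numeral_2_eq_2)
  qed
  have len: "length W = n" "length y = n" "\<forall>r\<in>set W. length r = m"
    using ok by (auto simp: affine_ok_def t)
  from n consider "n = 1" | "n = 2" by blast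
  then show thesis
  proof cases
    case 1
    then obtain r e where W: "W = [r]" "y = [e]"
      using len by (auto simp: length_Suc_conv)
    with len row obtain a b where "\<forall>v. length v = m \<longrightarrow>
        sum_list (map2 (*) r v) = a * fst (plane_point v) + b * snd (plane_point v)" by (metis list.set_intros(1))
    \<comment> \<open>A one-dimensional output gets a zero second row and offset to match the
      padding. The plane map is then singular, which \<open>injective_limit_affine\<close>
      permits.\<close>
    then show ?thesis
      by (intro that[of a b e 0 0 0]) (simp add: t W apply_affine_def plane_point_def)
  next
    case 2
    then obtain r s e f where W: "W = [r, s]" "y = [e, f]"
      using len by (auto simp: length_Suc_conv numeral_2_eq_2)
    with len row obtain a b where ab: "\<forall>v. length v = m \<longrightarrow>
        sum_list (map2 (*) r v) = a * fst (plane_point v) + b * snd (plane_point v)" by (metis list.set_intros(1))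
    from W len row obtain c d where "\<forall>v. length v = m \<longrightarrow>
        sum_list (map2 (*) s v) = c * fst (plane_point v) + d * snd (plane_point v)" by (metis list.set_intros)
    with ab show ?thesis
      by (intro that[of a b e c d f]) (simp add: t W apply_affine_def plane_point_def)
  qed
qed

lemma plane_point_relu:
  assumes "length v \<in> {1, 2}"
  shows "plane_point (relu_vec v) = (relu (fst (plane_point v)), relu (snd (plane_point v)))"
  using assms by (auto simp: plane_point_def relu_vec_def relu_def)

lemma injective_limit_apply_affine:
  assumes "affine_ok m n t" "m \<in> {1, 2}" "n \<in> {1, 2}" "\<And>x. length (h x) = m"
    and "injective_limit (\<lambda>x. plane_point (h x))"
  shows "injective_limit (\<lambda>x. plane_point (apply_affine t (h x)))"
proof -
  obtain a b e c d f where eq: "\<And>v. length v = m \<Longrightarrow> plane_point (apply_affine t v) =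
     (a * fst (plane_point v) + b * snd (plane_point v) + e,
      c * fst (plane_point v) + d * snd (plane_point v) + f)"
    by (rule plane_point_affine[OF assms(1-3)], rule that)
  show ?thesis
    using injective_limit_affine[OF assms(5), of a b e c d f] by (simp add: eq assms(4))
qed

text \<open>Induction on the layers with an arbitrary starting curve: the first hidden layer is
  absorbed into \<open>h\<close>, and the shorter network starts from the new curve.\<close>

lemma injective_limit_eval_net:
  assumes "ts \<noteq> []" "length ds = Suc (length ts)" "set ds \<subseteq> {1, 2}"
    and "\<forall>i < length ts. affine_ok (ds ! i) (ds ! Suc i) (ts ! i)"
    and "\<And>x. length (h x) = ds ! 0" "injective_limit (\<lambda>x. plane_point (h x))"
  shows "injective_limit (\<lambda>x. plane_point (eval_net ts (h x)))"
  using assms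
proof (induction ts arbitrary: ds h rule: induct_list012)
  case 1
  then show ?case by simp
next
  case (2 t)
  then have "ds ! 0 \<in> {1, 2}" "ds ! 1 \<in> {1, 2}"
    using nth_mem[of 0 ds] nth_mem[of 1 ds] by (auto simp del: nth_mem)
  with 2 show ?case
    using injective_limit_apply_affine[of "ds ! 0" "ds ! 1" t h] by simp
next
  case (3 t t' ts)
  obtain m n ds' where ds: "ds = m # n # ds'"
    using 3(4) by (auto simp: length_Suc_conv)
  have ok: "affine_ok m n t" using 3(6) ds by force
  have mn: "m \<in> {1, 2}" "n \<in> {1, 2}" using 3(5) ds by auto
  let ?k = "\<lambda>x. relu_vec (apply_affine t (h x))"
  have "injective_limit (\<lambda>x. plane_point (apply_affine t (h x)))"
    using injective_limit_apply_affine[OF ok mn] 3(7,8) ds by simp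
  from injective_limit_relu[OF this]
  have "injective_limit (\<lambda>x. plane_point (?k x))"
    using mn by (simp add: plane_point_relu length_apply_affine[OF ok])
  then have "injective_limit (\<lambda>x. plane_point (eval_net (t' # ts) (?k x)))"
    using 3(4,5,6) ds
    by (intro 3(2)[of "n # ds'"]) (auto simp: relu_vec_def length_apply_affine[OF ok])
  then show ?case by simp
qed

lemma injective_limit_net:
  assumes net: "is_net 1 2 ds ts" and w: "net_width ds \<le> 2"
  shows "injective_limit (\<lambda>x. plane_point (eval_net ts [x]))"
proof (rule injective_limit_eval_net)
  show "ts \<noteq> []" "length ds = Suc (length ts)"
    "\<forall>i < length ts. affine_ok (ds ! i) (ds ! Suc i) (ts ! i)"
    using net by (auto simp: is_net_def)
  show "length [x] = ds ! 0" for x :: real using net by (simp add: is_net_def)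
  have "ds ! i \<in> {1, 2}" if i: "i < length ds" for i
  proof -
    have "length ds = Suc (length ts)" using net by (simp add: is_net_def)
    then consider "i = 0" | "i = length ts" | "0 < i" "i < length ts"
      using i by linarith
    then show ?thesis
    proof cases
      case 3
      have "finite {ds ! i |i. 0 < i \<and> i < length ds - 1}" by simp
      then have "ds ! i \<le> net_width ds"
        unfolding net_width_def using 3 net by (intro Max_ge) (auto simp: is_net_def)
      moreover have "ds ! i \<ge> 1" using 3 net by (simp add: is_net_def)
      ultimately have "1 \<le> ds ! i" "ds ! i \<le> 2" using w by auto
      then show ?thesis by auto
    qed (use net in \<open>auto simp: is_net_def\<close>)
  qed
  then show "set ds \<subseteq> {1, 2}" by (metis in_set_conv_nth subsetI)
  \<comment> \<open>The embedded input \<open>(x, 0)\<close> is already injective and approximates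
    itself with error zero.\<close>
  show "injective_limit (\<lambda>x. plane_point [x])"
    unfolding injective_limit_def plane_point_def
    by (intro allI impI exI[of _ "\<lambda>x. (x, 0)"]) (auto intro!: continuous_intros inj_onI)
qed

section \<open>A crossing that survives perturbation\<close>

text \<open>Runs from $(-2,0)$ to $(2,0)$ on $[0,1/3]$ and from $(0,-2)$ to $(0,2)$ on $[2/3,1]$.\<close>

definition crossing_curve :: "real \<Rightarrow> real \<times> real" where
  "crossing_curve x = (min (12*x - 2) (max 0 (4 - 6*x)), max (min 0 (2 - 6*x)) (12*x - 10))"

lemma continuous_on_crossing_curve: "continuous_on S crossing_curve"
  unfolding crossing_curve_def by (intro continuous_intros)

text \<open>By the Fashoda theorem the clamped first and last thirds of \<open>g\<close> meet. There
  the horizontal piece has a small second coordinate and the vertical piece a small first one, so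
  clamping changed nothing and \<open>g\<close> takes one value twice.\<close>

lemma near_crossing_curve_not_inj:
  assumes cont: "continuous_on {0..1} g"
    and near: "\<And>x. x \<in> {0..1} \<Longrightarrow> \<bar>fst (g x) - fst (crossing_curve x)\<bar> \<le> 1/2 \<and>
                               \<bar>snd (g x) - snd (crossing_curve x)\<bar> \<le> 1/2"
  shows "\<not> inj_on g {0..1}"
proof
  assume inj: "inj_on g {0..1}"
  \<comment> \<open>The Fashoda theorem wants curves inside the square that end exactly on opposite
    sides. The pieces of \<open>g\<close> end only within 1/2 of coordinate -2 or 2, and clamping to
    [-1, 1] sends these ends to -1 and 1.\<close>
  define cl :: "real \<Rightarrow> real" where "cl u = max (-1) (min 1 u)" for u
  have cl_low: "\<bar>u + 2\<bar> * 2 \<le> 1 \<Longrightarrow> cl u = -1" for u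
    by (auto simp: cl_def max_def min_def abs_if split: if_splits)
  have cl_high: "\<bar>u - 2\<bar> * 2 \<le> 1 \<Longrightarrow> cl u = 1" for u
    by (auto simp: cl_def max_def min_def abs_if split: if_splits)
  \<comment> \<open>The clamp of \<open>v\<close> lies strictly inside (-1, 1), so \<open>u\<close>
    was not cut off either.\<close>
  have cl_cancel: "u = v" if "cl u = cl v" "\<bar>v\<bar> \<le> 1/2" for u v
    using that unfolding cl_def by linarith
  define \<Phi> :: "real \<times> real \<Rightarrow> real ^ 2" where "\<Phi> z = vector [cl (fst z), cl (snd z)]" for z
  have \<Phi>: "\<Phi> z $ 1 = cl (fst z)" "\<Phi> z $ 2 = cl (snd z)" for z
    by (simp_all add: \<Phi>_def)
  have cont_\<Phi>: "continuous_on UNIV \<Phi>"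
  proof -
    have "\<Phi> = (\<lambda>z. \<chi> i. if i = 1 then cl (fst z) else cl (snd z))"
      by (auto simp: fun_eq_iff vec_eq_iff forall_2 \<Phi>)
    moreover have "continuous_on UNIV (\<lambda>z::real \<times> real. if i = 1 then cl (fst z) else cl (snd z))"
      for i :: 2
      unfolding cl_def by (cases "i = 1") (auto intro!: continuous_intros)
    then have "continuous_on UNIV (\<lambda>z::real \<times> real. \<chi> i::2. if i = 1 then cl (fst z) else cl (snd z))"
      by (rule continuous_on_vec_lambda)
    ultimately show "continuous_on UNIV \<Phi>" by simp
  qed
  \<comment> \<open>Rescaling [-1, 1] onto [0, 1/3] for \<open>p\<close> and onto [2/3, 1] for
    \<open>q\<close>.\<close>
  define p where "p s = \<Phi> (g ((s+1)/6))" for s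
  define q where "q s = \<Phi> (g ((s+5)/6))" for s
  have gp: "\<bar>fst (g ((s+1)/6)) - 2 * s\<bar> \<le> 1/2" "\<bar>snd (g ((s+1)/6))\<bar> \<le> 1/2"
    and gq: "\<bar>fst (g ((s+5)/6))\<bar> \<le> 1/2" "\<bar>snd (g ((s+5)/6)) - 2 * s\<bar> \<le> 1/2"
    if "s \<in> {-1..1}" for s
  proof -
    have "crossing_curve ((s+1)/6) = (2 * s, 0)" "crossing_curve ((s+5)/6) = (0, 2 * s)"
      using that by (auto simp: crossing_curve_def field_simps)
    then show "\<bar>fst (g ((s+1)/6)) - 2 * s\<bar> \<le> 1/2" "\<bar>snd (g ((s+1)/6))\<bar> \<le> 1/2"
      "\<bar>fst (g ((s+5)/6))\<bar> \<le> 1/2" "\<bar>snd (g ((s+5)/6)) - 2 * s\<bar> \<le> 1/2"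
      using near[of "(s+1)/6"] near[of "(s+5)/6"] that by auto
  qed
  have "\<exists>s\<in>{-1..1}. \<exists>t\<in>{-1..1}. p s = q t"
  proof (rule fashoda_unit)
    show "p ` {-1..1} \<subseteq> cbox (-1) 1" "q ` {-1..1} \<subseteq> cbox (-1) 1"
      by (auto simp: p_def q_def mem_box_cart forall_2 \<Phi> cl_def)
    show "continuous_on {-1..1} p" unfolding p_def
      by (rule continuous_on_compose2[OF cont_\<Phi> continuous_on_compose2[OF cont]])
        (auto intro!: continuous_intros)
    show "continuous_on {-1..1} q" unfolding q_def
      by (rule continuous_on_compose2[OF cont_\<Phi> continuous_on_compose2[OF cont]])
        (auto intro!: continuous_intros)
    show "p (-1) $ 1 = -1" "p 1 $ 1 = 1" "q (-1) $ 2 = -1" "q 1 $ 2 = 1"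
      using gp[of "-1"] gp[of 1] gq[of "-1"] gq[of 1] by (auto simp: p_def q_def \<Phi> intro!: cl_low cl_high)
  qed
  then obtain s t where st: "s \<in> {-1..1}" "t \<in> {-1..1}" "p s = q t" by blast
  have "cl (fst (g ((s+1)/6))) = cl (fst (g ((t+5)/6)))"
       "cl (snd (g ((s+1)/6))) = cl (snd (g ((t+5)/6)))"
    using st(3) by (metis p_def q_def \<Phi>)+
  then have "g ((s+1)/6) = g ((t+5)/6)"
    using gp[OF st(1)] gq[OF st(2)] by (metis cl_cancel prod_eqI)
  then have "(s+1)/6 = (t+5)/6"
    using inj st(1,2) by (auto dest!: inj_onD)
  \<comment> \<open>The left side is at most 1/3 and the right side at least 2/3.\<close>
  with st(1,2) show False by auto
qed

lemma not_dense_width_le_2: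
  assumes "w \<le> 2"
  shows "\<not> relu_dense_width_1_2 w"
proof
  assume "relu_dense_width_1_2 w"
  \<comment> \<open>Network error 1/4 plus distance 1/4 to an injective curve gives the tolerance
    1/2 of \<open>near_crossing_curve_not_inj\<close>.\<close>
  then have "\<exists>ds ts. is_net 1 2 ds ts \<and> net_width ds = w \<and>
           (\<forall>x\<in>{0..1}. \<bar>fst (crossing_curve x) - eval_net ts [x] ! 0\<bar> \<le> 1/4 \<and>
                        \<bar>snd (crossing_curve x) - eval_net ts [x] ! 1\<bar> \<le> 1/4)"
    unfolding relu_dense_width_1_2_def
    using continuous_on_crossing_curve by (metis zero_less_divide_1_iff zero_less_numeral)
  then obtain ds ts where net: "is_net 1 2 ds ts" "net_width ds = w"
    and near: "\<And>x. x \<in> {0..1} \<Longrightarrow> \<bar>fst (crossing_curve x) - eval_net ts [x] ! 0\<bar> \<le> 1/4 \<and>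
                        \<bar>snd (crossing_curve x) - eval_net ts [x] ! 1\<bar> \<le> 1/4" by blast
  obtain g where g: "continuous_on {0..1} g" "inj_on g {0..1}"
      "\<And>x. x \<in> {0..1} \<Longrightarrow> dist (g x) (plane_point (eval_net ts [x])) \<le> 1/4"
    using injective_limit_net[OF net(1)] net(2) assms unfolding injective_limit_def
    by (metis zero_less_divide_1_iff zero_less_numeral)
  have len: "length (eval_net ts [x]) = 2" for x
    using length_eval_net[OF net(1)] .
  have "\<bar>fst (g x) - fst (crossing_curve x)\<bar> \<le> 1/2 \<and> \<bar>snd (g x) - snd (crossing_curve x)\<bar> \<le> 1/2"
    if x: "x \<in> {0..1}" for x
    using near[OF x] order_trans[OF dist_fst_le g(3)[OF x]] order_trans[OF dist_snd_le g(3)[OF x]]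
    unfolding plane_point_def len dist_real_def abs_le_iff by auto
  with near_crossing_curve_not_inj[OF g(1)] g(2) show False by blast
qed


section \<open>Networks of width at least three\<close>

text \<open>The first neuron carries the input $x \ge 0$; each coordinate of \<open>G\<close> is read off from
  one further neuron up to an affine function of $x$.\<close>

definition realizable :: "nat \<Rightarrow> (real \<Rightarrow> real \<times> real) \<Rightarrow> bool" where
  "realizable w G \<longleftrightarrow> (\<exists>t ts a b s\<^sub>1 m\<^sub>1 c\<^sub>1 s\<^sub>2 m\<^sub>2 c\<^sub>2.
     affine_ok 1 w t \<and> (\<forall>u\<in>set ts. affine_ok w w u) \<and>
     (\<forall>x\<in>{0..1}. hidden_state (t # ts) [x] = [x, a x, b x] @ replicate (w - 3) 0 \<and>
        G x = (s\<^sub>1 * a x + m\<^sub>1 * x + c\<^sub>1, s\<^sub>2 * b x + m\<^sub>2 * x + c\<^sub>2)))"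

lemma realizableI:
  assumes "affine_ok 1 w t" "\<And>u. u \<in> set ts \<Longrightarrow> affine_ok w w u"
    and "\<And>x. x \<in> {0..1} \<Longrightarrow> hidden_state (t # ts) [x] = [x, a x, b x] @ replicate (w - 3) 0"
    and "\<And>x. x \<in> {0..1} \<Longrightarrow> G x = (s\<^sub>1 * a x + m\<^sub>1 * x + c\<^sub>1, s\<^sub>2 * b x + m\<^sub>2 * x + c\<^sub>2)"
  shows "realizable w G"
  unfolding realizable_def
  by (rule exI[of _ t], rule exI[of _ ts], rule exI[of _ a], rule exI[of _ b], rule exI[of _ s\<^sub>1],
      rule exI[of _ m\<^sub>1], rule exI[of _ c\<^sub>1], rule exI[of _ s\<^sub>2], rule exI[of _ m\<^sub>2], rule exI[of _ c\<^sub>2])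
    (intro conjI ballI assms)

lemma realizable_const:
  assumes "w \<ge> 3"
  shows "realizable w (\<lambda>x. z)"
proof -
  \<comment> \<open>This layer only copies \<open>x\<close>, which ReLU fixes on [0, 1]. The
    constant \<open>z\<close> enters through the offsets of the read-off.\<close>
  let ?t = "([[1], [0], [0]] @ replicate (w - 3) [0], replicate w 0) :: affine"
  obtain k where w: "w = k + 3" using assms by (metis add.commute le_Suc_ex)
  have "affine_ok 1 w ?t" using assms by (auto simp: affine_ok_def)
  moreover have "hidden_state [?t] [x] = [x, 0, 0] @ replicate (w - 3) 0" if "x \<in> {0..1}" for x
    using that by (simp add: w hidden_state_def apply_affine_def relu_vec_def relu_def numeral_3_eq_3)
  ultimately show ?thesis
    by (intro realizableI[where t = ?t and ts = "[]" and a = "\<lambda>_. 0" and b = "\<lambda>_. 0"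
          and s\<^sub>1 = 0 and m\<^sub>1 = 0 and c\<^sub>1 = "fst z" and s\<^sub>2 = 0 and m\<^sub>2 = 0 and c\<^sub>2 = "snd z"]) auto
qed

lemma sum_list_map2_padded:
  fixes p q r x y z :: real
  shows "sum_list (map2 (*) ([p, q, r] @ replicate k 0) ([x, y, z] @ replicate k 0)) =
    p * x + q * y + r * z"
  by (simp add: sum_list_replicate)

text \<open>For \<open>\<sigma> = 1\<close> this is the maximum with an affine function, for \<open>\<sigma> = -1\<close> the minimum.\<close>

lemma realizable_relu_step:
  assumes w: "w \<ge> 3" and G: "realizable w G"
  shows "realizable w (\<lambda>x.
    (\<sigma> * relu (\<sigma> * (fst (G x) - (m * x + c))) + m * x + c,
     \<sigma> * relu (\<sigma> * (snd (G x) - (n * x + d))) + n * x + d))"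
proof -
  obtain k where k: "w = k + 3" using w by (metis add.commute le_Suc_ex)
  obtain t ts a b s\<^sub>1 m\<^sub>1 c\<^sub>1 s\<^sub>2 m\<^sub>2 c\<^sub>2 where
    ok: "affine_ok 1 w t" "\<forall>u\<in>set ts. affine_ok w w u" and
    state: "\<And>x. x \<in> {0..1} \<Longrightarrow> hidden_state (t # ts) [x] = [x, a x, b x] @ replicate k 0" and
    read: "\<And>x. x \<in> {0..1} \<Longrightarrow> G x = (s\<^sub>1 * a x + m\<^sub>1 * x + c\<^sub>1, s\<^sub>2 * b x + m\<^sub>2 * x + c\<^sub>2)"
    using G k unfolding realizable_def by auto
  let ?z = "replicate k (0::real)"
  \<comment> \<open>Rows two and three substitute the old read-off into \<open>\<sigma>\<close>
    times (value minus line). The new read-off multiplies by \<open>\<sigma>\<close> and adds the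
    line back.\<close>
  let ?u = "([[1, 0, 0] @ ?z, [\<sigma> * (m\<^sub>1 - m), \<sigma> * s\<^sub>1, 0] @ ?z, [\<sigma> * (m\<^sub>2 - n), 0, \<sigma> * s\<^sub>2] @ ?z]
      @ replicate k ([0, 0, 0] @ ?z), [0, \<sigma> * (c\<^sub>1 - c), \<sigma> * (c\<^sub>2 - d)] @ ?z) :: affine"
  let ?a = "\<lambda>x. relu (\<sigma> * (fst (G x) - (m * x + c)))"
  let ?b = "\<lambda>x. relu (\<sigma> * (snd (G x) - (n * x + d)))"
  have u: "affine_ok w w ?u" by (auto simp: affine_ok_def k)
  have "relu_vec (apply_affine ?u ([x, a x, b x] @ ?z)) = [x, ?a x, ?b x] @ ?z"
    if "x \<in> {0..1}" for x
    using that unfolding apply_affine_def relu_vec_def fst_conv snd_conv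
    by (simp add: sum_list_map2_padded[simplified] read) (simp add: relu_def algebra_simps)
  then have "hidden_state (t # ts @ [?u]) [x] = [x, ?a x, ?b x] @ replicate (w - 3) 0"
    if "x \<in> {0..1}" for x
    using that state[OF that] by (simp add: hidden_state_def k)
  moreover have "affine_ok w w v" if "v \<in> set (ts @ [?u])" for v using ok(2) u that by auto
  ultimately show ?thesis
    using ok(1) by (intro realizableI[where t = t and ts = "ts @ [?u]" and a = ?a and b = ?b
          and s\<^sub>1 = \<sigma> and m\<^sub>1 = m and c\<^sub>1 = c and s\<^sub>2 = \<sigma> and m\<^sub>2 = n and c\<^sub>2 = d]) simp_all
qed

lemma realizable_max:
  assumes "w \<ge> 3" "realizable w G"
  shows "realizable w (\<lambda>x. (max (fst (G x)) (m * x + c), max (snd (G x)) (n * x + d)))"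
proof -
  have "1 * relu (1 * (u - (a * x + b))) + a * x + b = max u (a * x + b)" for u a x b
    by (simp add: relu_def max_def)
  with realizable_relu_step[OF assms, of 1 m c n d] show ?thesis by simp
qed

lemma realizable_min:
  assumes "w \<ge> 3" "realizable w G"
  shows "realizable w (\<lambda>x. (min (fst (G x)) (m * x + c), min (snd (G x)) (n * x + d)))"
proof -
  have "(-1) * relu ((-1) * (u - (a * x + b))) + a * x + b = min u (a * x + b)" for u a x b
    by (simp add: relu_def max_def min_def)
  with realizable_relu_step[OF assms, of "-1" m c n d] show ?thesis by simp
qed

text \<open>The read-off is affine in the hidden state, so it serves as the last map, after which no
  ReLU follows.\<close>

lemma realizable_imp_net:
  assumes w: "w \<ge> 3" and G: "realizable w G"
  shows "\<exists>ds ts. is_net 1 2 ds ts \<and> net_width ds = w \<and>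
     (\<forall>x\<in>{0..1}. eval_net ts [x] = [fst (G x), snd (G x)])"
proof -
  obtain k where k: "w = k + 3" using w by (metis add.commute le_Suc_ex)
  obtain t ts a b s\<^sub>1 m\<^sub>1 c\<^sub>1 s\<^sub>2 m\<^sub>2 c\<^sub>2 where
    ok: "affine_ok 1 w t" "\<forall>u\<in>set ts. affine_ok w w u" and
    state: "\<And>x. x \<in> {0..1} \<Longrightarrow> hidden_state (t # ts) [x] = [x, a x, b x] @ replicate k 0" and
    read: "\<And>x. x \<in> {0..1} \<Longrightarrow> G x = (s\<^sub>1 * a x + m\<^sub>1 * x + c\<^sub>1, s\<^sub>2 * b x + m\<^sub>2 * x + c\<^sub>2)"
    using G k unfolding realizable_def by auto
  let ?z = "replicate k (0::real)"
  let ?u = "([[m\<^sub>1, s\<^sub>1, 0] @ ?z, [m\<^sub>2, 0, s\<^sub>2] @ ?z], [c\<^sub>1, c\<^sub>2]) :: affine"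
  let ?n = "Suc (length ts)"
  \<comment> \<open>Each of \<open>t\<close> and \<open>ts\<close> feeds one hidden layer, so
    indices 1 to \<open>?n\<close> are exactly the hidden ones.\<close>
  let ?ds = "1 # replicate ?n w @ [2]" and ?ts = "(t # ts) @ [?u]"
  have ds: "?ds ! i = w" if "0 < i" "i \<le> ?n" for i
    using that by (cases i) (auto simp: nth_append nth_Cons')
  have ds_last: "?ds ! Suc ?n = 2" by (simp add: nth_append)
  have u: "affine_ok w 2 ?u" by (simp add: affine_ok_def k)
  have "affine_ok (?ds ! i) (?ds ! Suc i) (?ts ! i)" if i: "i < length ?ts" for i
  proof -
    consider "i = 0" | "0 < i" "i < ?n" | "i = ?n" using i by fastforce
    then show ?thesis
    proof cases
      case 1
      then show ?thesis using ok(1) by simp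
    next
      case 2
      then have "?ts ! i \<in> set ts" by (auto simp: nth_append nth_Cons')
      then show ?thesis using 2 ok(2) ds[of i] ds[of "Suc i"] by (metis Suc_leI less_imp_le_nat zero_less_Suc)
    next
      case 3
      have "?ts ! ?n = ?u" by (simp add: nth_append)
      then show ?thesis using 3 ds[of ?n] ds_last u by (metis order_refl zero_less_Suc)
    qed
  qed
  moreover have "?ds ! i \<ge> 1" if "0 < i" "i < length ?ts" for i
    using ds[of i] that w by simp
  ultimately have "is_net 1 2 ?ds ?ts"
    unfolding is_net_def using ds_last by simp
  moreover have "net_width ?ds = w"
  proof -
    have "{?ds ! i | i. 0 < i \<and> i < length ?ds - 1} = {w}"
    proof
      show "{?ds ! i | i. 0 < i \<and> i < length ?ds - 1} \<subseteq> {w}" using ds by auto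
      show "{w} \<subseteq> {?ds ! i | i. 0 < i \<and> i < length ?ds - 1}"
        using ds[of 1] by (auto intro!: exI[of _ 1])
    qed
    then show ?thesis unfolding net_width_def by simp
  qed
  moreover have "eval_net ?ts [x] = [fst (G x), snd (G x)]" if "x \<in> {0..1}" for x
    unfolding eval_net_snoc state[OF that]
    by (simp add: apply_affine_def sum_list_map2_padded[simplified] read[OF that])
  ultimately show ?thesis by blast
qed

section \<open>Approximation by successive clamping\<close>

text \<open>Supplies the slope \<open>K\<close> of the clamping lines. Uniform continuity handles
  points closer than \<open>\<delta>\<close>; for the others the bound \<open>M\<close> on all
  distances is at most \<open>M / \<delta>\<close> times their gap.\<close>

lemma continuous_on_coarse_Lipschitz:
  fixes f :: "real \<Rightarrow> 'a::real_normed_vector"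
  assumes "continuous_on {0..1} f" "e > 0"
  obtains K where "K \<ge> 0" "\<And>x y. x \<in> {0..1} \<Longrightarrow> y \<in> {0..1} \<Longrightarrow> dist (f x) (f y) \<le> e + K * \<bar>x - y\<bar>"
proof -
  have "uniformly_continuous_on {0..1} f"
    using assms(1) by (simp add: compact_uniformly_continuous)
  then obtain \<delta> where \<delta>: "\<delta> > 0"
    "\<And>x y. x \<in> {0..1} \<Longrightarrow> y \<in> {0..1} \<Longrightarrow> dist x y < \<delta> \<Longrightarrow> dist (f x) (f y) < e"
    using assms(2) unfolding uniformly_continuous_on_def by metis
  have "bounded (f ` {0..1})"
    using assms(1) by (simp add: compact_continuous_image compact_imp_bounded)
  then obtain M where M: "\<And>x y. x \<in> {0..1} \<Longrightarrow> y \<in> {0..1} \<Longrightarrow> dist (f x) (f y) \<le> M"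
    unfolding bounded_two_points by blast
  have M0: "M \<ge> 0" using M[of 0 0] by simp
  show thesis
  proof (rule that[of "M / \<delta>"])
    show "M / \<delta> \<ge> 0" using M0 \<delta>(1) by simp
    fix x y :: real assume xy: "x \<in> {0..1}" "y \<in> {0..1}"
    show "dist (f x) (f y) \<le> e + M / \<delta> * \<bar>x - y\<bar>"
    proof (cases "\<bar>x - y\<bar> < \<delta>")
      case True
      then have "dist (f x) (f y) < e" using \<delta>(2)[OF xy] by (simp add: dist_real_def)
      moreover have "0 \<le> M / \<delta> * \<bar>x - y\<bar>" using M0 \<delta>(1) by simp
      ultimately show ?thesis by linarith
    next
      case False
      then have "M / \<delta> * \<delta> \<le> M / \<delta> * \<bar>x - y\<bar>"
        using M0 \<delta>(1) by (intro mult_left_mono) auto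
      then show ?thesis using M[OF xy] assms(2) \<delta>(1) by simp
    qed
  qed
qed

text \<open>Clamping between the two lines through $(p, f(p) \pm e)$ with slopes $\mp K$ does no harm left
  of $p$, since \<open>f\<close> stays between the lines there, and repairs the approximation just right of $p$.\<close>

lemma clamp_step:
  fixes f g :: "real \<Rightarrow> real"
  assumes Lip: "\<bar>f x - f p\<bar> \<le> e + K * \<bar>x - p\<bar>" and K: "K \<ge> 0" "K * h \<le> e" and "x \<le> p + h"
    and left: "x \<le> p \<Longrightarrow> \<bar>g x - f x\<bar> \<le> 3 * e" and e: "e > 0"
  shows "\<bar>max (min (g x) ((- K) * x + (f p + e + K * p))) (K * x + (f p - e - K * p)) - f x\<bar> \<le> 3 * e"
proof -
  define y where "y = K * (x - p)"
  have y1: "(- K) * x + (f p + e + K * p) = f p + e - y" "K * x + (f p - e - K * p) = f p - e + y"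
    by (simp_all add: y_def algebra_simps)
  show ?thesis
  proof (cases "x \<le> p")
    \<comment> \<open>The lines lie at \<open>f p\<close> plus and minus
      \<open>e + K * \<bar>x - p\<bar>\<close> and enclose \<open>f x\<close>; clamping to an
      interval containing \<open>f x\<close> does not increase the error.\<close>
    case True
    then have "K * \<bar>x - p\<bar> = - y" by (simp add: y_def algebra_simps)
    then show ?thesis unfolding y1 using left[OF True] Lip e by (auto simp: abs_le_iff)
  next
    \<comment> \<open>Now \<open>y\<close> lies between 0 and \<open>e\<close>, so the lines have
      not crossed and the clamped value is within \<open>e\<close> of \<open>f p\<close>, while
      \<open>f x\<close> is within \<open>2 * e\<close> of it.\<close>
    case False
    then have "K * \<bar>x - p\<bar> = y" "0 \<le> y" using K by (simp_all add: y_def)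
    moreover have "y \<le> K * h" unfolding y_def using assms(4) K by (intro mult_left_mono) auto
    ultimately show ?thesis unfolding y1 using Lip e K by (auto simp: abs_le_iff)
  qed
qed

text \<open>Induction over the grid points \<open>n * h\<close>: the error bound holds up to
  \<open>n * h\<close>, and clamping at that point extends it by one grid cell in both coordinates
  at once.\<close>

lemma realizable_approximation:
  assumes w: "w \<ge> 3" and cont: "continuous_on {0..1} f" and e: "e > 0"
  shows "\<exists>G. realizable w G \<and>
    (\<forall>x\<in>{0..1}. \<bar>fst (G x) - fst (f x)\<bar> \<le> 3 * e \<and> \<bar>snd (G x) - snd (f x)\<bar> \<le> 3 * e)"
proof -
  obtain K where K: "K \<ge> 0"
    "\<And>x y. x \<in> {0..1} \<Longrightarrow> y \<in> {0..1} \<Longrightarrow> dist (f x) (f y) \<le> e + K * \<bar>x - y\<bar>"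
    using continuous_on_coarse_Lipschitz[OF cont e] by blast
  \<comment> \<open>More than \<open>K / e\<close> cells make the lines rise by at most
    \<open>e\<close> across one cell.\<close>
  obtain N where N: "K / e < real N" "0 < N"
    using reals_Archimedean2[of "max (K / e) 0"] by auto
  define h where "h = 1 / real N"
  have h: "h > 0" "N * h = 1" "K * h \<le> e" using N e by (auto simp: h_def field_simps)
  have Lip: "\<bar>fst (f x) - fst (f y)\<bar> \<le> e + K * \<bar>x - y\<bar>" "\<bar>snd (f x) - snd (f y)\<bar> \<le> e + K * \<bar>x - y\<bar>"
    if "x \<in> {0..1}" "y \<in> {0..1}" for x y
    using order_trans[OF dist_fst_le K(2)[OF that]] order_trans[OF dist_snd_le K(2)[OF that]]
    by (simp_all add: dist_real_def)
  have "\<exists>G. realizable w G \<and> (\<forall>x\<in>{0..1}. x \<le> n * h \<longrightarrow>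
      \<bar>fst (G x) - fst (f x)\<bar> \<le> 3 * e \<and> \<bar>snd (G x) - snd (f x)\<bar> \<le> 3 * e)" if "n \<le> N" for n
    using that
  proof (induction n)
    case 0
    show ?case
      \<comment> \<open>Only \<open>x = 0\<close> has to be matched, and the constant
        \<open>f 0\<close> is exact there.\<close>
      using e by (intro exI[of _ "\<lambda>x. f 0"]) (auto simp: realizable_const[OF w])
  next
    case (Suc n)
    then obtain G where G: "realizable w G"
      "\<And>x. x \<in> {0..1} \<Longrightarrow> x \<le> n * h \<Longrightarrow> \<bar>fst (G x) - fst (f x)\<bar> \<le> 3 * e \<and> \<bar>snd (G x) - snd (f x)\<bar> \<le> 3 * e"
      by auto
    define p where "p = n * h"
    have "n * h \<le> N * h" using Suc.prems h(1) by (intro mult_right_mono) auto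
    then have p: "p \<in> {0..1}" using h by (simp add: p_def)
    \<comment> \<open>Right of \<open>p + h\<close> the lines may cross and nothing is claimed;
      later clamps take care of that region.\<close>
    let ?G = "\<lambda>x. (max (min (fst (G x)) ((- K) * x + (fst (f p) + e + K * p))) (K * x + (fst (f p) - e - K * p)),
        max (min (snd (G x)) ((- K) * x + (snd (f p) + e + K * p))) (K * x + (snd (f p) - e - K * p)))"
    have "realizable w ?G"
      by (rule realizable_max[OF w realizable_min[OF w G(1)], unfolded fst_conv snd_conv])
    moreover have "\<bar>fst (?G x) - fst (f x)\<bar> \<le> 3 * e \<and> \<bar>snd (?G x) - snd (f x)\<bar> \<le> 3 * e"
      if x: "x \<in> {0..1}" "x \<le> Suc n * h" for x
    proof -
      have "x \<le> p + h" using x(2) by (simp add: p_def algebra_simps)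
      then show ?thesis
        using clamp_step[of "\<lambda>x. fst (f x)" x p e K h "\<lambda>x. fst (G x)"]
          clamp_step[of "\<lambda>x. snd (f x)" x p e K h "\<lambda>x. snd (G x)"]
          Lip[OF x(1) p] K(1) h(3) e G(2)[OF x(1)] by (simp add: p_def)
    qed
    ultimately show ?case by blast
  qed
  from this[of N] show ?thesis using h(2) by auto
qed

lemma dense_width_ge_3:
  assumes w: "w \<ge> 3"
  shows "relu_dense_width_1_2 w"
  unfolding relu_dense_width_1_2_def
proof (intro allI impI, elim conjE)
  fix f :: "real \<Rightarrow> real \<times> real" and \<epsilon> :: real
  assume "continuous_on {0..1} f" "\<epsilon> > 0"
  then obtain G where G: "realizable w G"
    "\<And>x. x \<in> {0..1} \<Longrightarrow> \<bar>fst (G x) - fst (f x)\<bar> \<le> \<epsilon> \<and> \<bar>snd (G x) - snd (f x)\<bar> \<le> \<epsilon>"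
    \<comment> \<open>The third compensates for the factor 3 in the error bound.\<close>
    using realizable_approximation[OF w, of f "\<epsilon>/3"] by auto
  obtain ds ts where "is_net 1 2 ds ts" "net_width ds = w"
    "\<And>x. x \<in> {0..1} \<Longrightarrow> eval_net ts [x] = [fst (G x), snd (G x)]"
    using realizable_imp_net[OF w G(1)] by blast
  with G(2) show "\<exists>ds ts. is_net 1 2 ds ts \<and> net_width ds = w \<and>
           (\<forall>x\<in>{0..1}. \<bar>fst (f x) - eval_net ts [x] ! 0\<bar> \<le> \<epsilon> \<and>
                        \<bar>snd (f x) - eval_net ts [x] ! 1\<bar> \<le> \<epsilon>)"
    by (intro exI[of _ ds] exI[of _ ts]) (auto simp: abs_minus_commute)
qed

theorem theorem2:
  fixes w :: nat
  shows "relu_dense_width_1_2 w \<longleftrightarrow> w \<ge> 3"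
  using dense_width_ge_3 not_dense_width_le_2 by (metis not_less_eq_eq numeral_2_eq_2 numeral_3_eq_3)

end
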